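(* Let $T$ be a nontrivial finite metric tree of length $L=|T|$, let $0<R\le L$, and let $\beta$ be a finite positive Borel measure on $[0,R]$ (extended by zero to $\mathbb R_{\ge0}$) satisfying the following equivalent conditions: (a) there is a probability measure $\nu$ on $\mathcal C(T,0)$ with $E_\nu\le\beta$; (b) there is a fractional marked-ball cover $\xi$ of $T$ on $X_{T,R}=T\times[0,R]$ with $\pi_*\xi\le\beta$; (c) every finite positive Borel measure $\sigma$ on $T$ satisfies $\sigma(T)\le\int_{[0,R]}\max_{v\in T}\sigma(B_T(v,s))\,d\beta(s)$. Then: (i) The maximal ball-volume profile satisfies $$L\le\int_{[0,R]}V_T(s)\,d\beta(s).$$ (ii) If $T$ contains $m\ge2$ points whose pairwise distances are at least $\delta>0$, then $$m\le\beta\bigl([0,R]\cap[0,\delta/2)\bigr)+m\,\beta\bigl([0,R]\cap[\delta/2,\infty)\bigr).$$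
   Context: A finite metric tree is the metric realization of a finite combinatorial tree whose edges have positive lengths; it is nontrivial if it is not a single point. $|T|$ is the total edge length, $d_T$ the path metric, and $B_T(v,s)=\{x\in T: d_T(x,v)\le s\}$. $\ell_T$ is length measure on $T$ and $V_T(s)=\max_{v\in T}\ell_T(B_T(v,s))$ is the maximal ball-volume profile. For $m\ge1$, a tuple $\mathbf r=(r_1,\dots,r_m)\in\mathbb R_{\ge0}^m$ is a cover of $T$ if there are $v_1,\dots,v_m\in T$ with $T\subseteq\bigcup_i B_T(v_i,r_i)$; $\mathcal C_m(T)$ is the set of such tuples, $\mathcal C(T)=\bigsqcup_{m\ge1}\mathcal C_m(T)$ with the disjoint-union Borel structure, and $\mathcal C(T,0)=\{\mathbf r\in\mathcal C(T):\sum_i r_i\le|T|\}$. For a finite Borel measure $\nu$ on $\mathcal C(T)$, $E_\nu(A)=\int|\{i:r_i\in A\}|\,d\nu(\mathbf r)$ for Borel $A\subseteq\mathbb R_{\ge0}$. $\mu\le\mu'$ means $\mu(A)\le\mu'(A)$ for all Borel $A$. With $\pi(v,s)=s$ on $X_{T,R}$, a fractional marked-ball cover of $T$ on $X_{T,R}$ is a finite positive Borel measure $\xi$ on $X_{T,R}$ with $\xi(\{(v,s):d_T(x,v)\le s\})\ge1$ for every $x\in T$. *)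

theory Defs
  imports "HOL-Probability.Probability"
begin

section \<open>Finite combinatorial trees with edge lengths\<close>

record 'v weighted_graph =
  verts :: "'v set"
  edges :: "'v set set"
  elen  :: "'v set \<Rightarrow> real"

definition graph_connected :: "'v weighted_graph \<Rightarrow> bool" where
  "graph_connected T \<longleftrightarrow>
     (\<forall>u\<in>verts T. \<forall>v\<in>verts T. (u, v) \<in> {(a, b). {a, b} \<in> edges T}\<^sup>*)"

definition graph_acyclic :: "'v weighted_graph \<Rightarrow> bool" where
  "graph_acyclic T \<longleftrightarrow>
     \<not> (\<exists>c. 3 \<le> length c \<and> distinct c \<and>
          (\<forall>i<length c. {c ! i, c ! (Suc i mod length c)} \<in> edges T))"

definition finite_tree :: "'v weighted_graph \<Rightarrow> bool" where
  "finite_tree T \<longleftrightarrow>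
     finite (verts T) \<and> verts T \<noteq> {} \<and>
     edges T \<subseteq> {{u, v} | u v. u \<in> verts T \<and> v \<in> verts T \<and> u \<noteq> v} \<and>
     graph_connected T \<and> graph_acyclic T \<and>
     (\<forall>e\<in>edges T. 0 < elen T e)"


section \<open>The metric realization\<close>

text \<open>
  Points of the realization are given by barycentric coordinates \<open>x :: 'v \<Rightarrow> real\<close>, as in the
  geometric realization of a one-dimensional simplicial complex.
\<close>

definition cell :: "'v set \<Rightarrow> ('v \<Rightarrow> real) set" where
  "cell e = {x. (\<forall>v. 0 \<le> x v) \<and> (\<forall>v. v \<notin> e \<longrightarrow> x v = 0) \<and> (\<Sum>v\<in>e. x v) = 1}"

text \<open>The vertices are listed separately for the sake of the tree with one vertex and no edge.\<close>

definition points :: "'v weighted_graph \<Rightarrow> ('v \<Rightarrow> real) set" where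
  "points T = (\<Union>v\<in>verts T. cell {v}) \<union> (\<Union>e\<in>edges T. cell e)"

definition nontrivial :: "'v weighted_graph \<Rightarrow> bool" where
  "nontrivial T \<longleftrightarrow> \<not> (\<exists>p. points T = {p})"

text \<open>
  A closed edge \<open>e = {u, v}\<close> is a segment of length \<open>elen T e\<close>. Since the two coordinates of a point
  of \<open>e\<close> add up to 1, both of them differ by the same amount between two points of \<open>e\<close>; averaging
  over the two endpoints only avoids choosing one of them.
\<close>

definition edge_dist :: "'v weighted_graph \<Rightarrow> 'v set \<Rightarrow> ('v \<Rightarrow> real) \<Rightarrow> ('v \<Rightarrow> real) \<Rightarrow> real" where
  "edge_dist T e x y = elen T e * ((\<Sum>v\<in>e. \<bar>x v - y v\<bar>) / 2)"

text \<open>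
  \<open>pl_path T x l y\<close>: there is a piecewise linear path of length \<open>l\<close> from \<open>x\<close> to \<open>y\<close>, that is, a
  finite chain of points in which consecutive points lie in a common closed edge.
\<close>

inductive pl_path :: "'v weighted_graph \<Rightarrow> ('v \<Rightarrow> real) \<Rightarrow> real \<Rightarrow> ('v \<Rightarrow> real) \<Rightarrow> bool"
  for T :: "'v weighted_graph" where
  refl: "x \<in> points T \<Longrightarrow> pl_path T x 0 x"
| step: "e \<in> edges T \<Longrightarrow> x \<in> cell e \<Longrightarrow> y \<in> cell e \<Longrightarrow> pl_path T y l z
          \<Longrightarrow> pl_path T x (edge_dist T e x y + l) z"

text \<open>The value 0 off the realization is a convention: \<open>Metric_space\<close> wants a total nonnegative function.\<close>

definition path_dist :: "'v weighted_graph \<Rightarrow> ('v \<Rightarrow> real) \<Rightarrow> ('v \<Rightarrow> real) \<Rightarrow> real" where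
  "path_dist T x y = (if x \<in> points T \<and> y \<in> points T then Inf {l. pl_path T x l y} else 0)"

text \<open>\<open>path_dist\<close> is a metric on the realization, so \<open>mtopology\<close> and \<open>mcball\<close> below are meaningful.\<close>

lemma edge_dist_commute: "edge_dist T e x y = edge_dist T e y x"
  by (simp add: edge_dist_def abs_minus_commute)

lemma pl_path_trans: "pl_path T x l y \<Longrightarrow> pl_path T y l' z \<Longrightarrow> pl_path T x (l + l') z"
  by (induction rule: pl_path.induct) (auto simp: add.assoc intro: pl_path.step)

lemma cell_subset_points: "e \<in> edges T \<Longrightarrow> cell e \<subseteq> points T"
  by (auto simp: points_def)

lemma pl_path_edge:
  assumes "e \<in> edges T" "x \<in> cell e" "y \<in> cell e"
  shows "pl_path T x (edge_dist T e x y) y"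
  using pl_path.step[OF assms pl_path.refl] cell_subset_points[OF assms(1)] assms(3) by auto

lemma pl_path_sym: "pl_path T x l y \<Longrightarrow> pl_path T y l x"
proof (induction rule: pl_path.induct)
  case (step e x y l z)
  then have "pl_path T z (l + edge_dist T e y x) x"
    by (blast intro: pl_path_trans pl_path_edge)
  then show ?case by (simp add: edge_dist_commute add.commute)
qed (rule pl_path.refl)

lemma edge_dist_nonneg: "finite_tree T \<Longrightarrow> e \<in> edges T \<Longrightarrow> 0 \<le> edge_dist T e x y"
  unfolding edge_dist_def finite_tree_def
  by (rule mult_nonneg_nonneg) (blast intro: less_imp_le, simp add: sum_nonneg)

lemma pl_path_nonneg:
  assumes "finite_tree T" shows "pl_path T x l y \<Longrightarrow> 0 \<le> l"
  by (induction rule: pl_path.induct) (use edge_dist_nonneg[OF assms] in \<open>auto intro: add_nonneg_nonneg\<close>)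

lemma edge_cases:
  assumes "finite_tree T" "e \<in> edges T"
  obtains u v where "e = {u, v}" "u \<in> verts T" "v \<in> verts T" "u \<noteq> v"
  using assms unfolding finite_tree_def by blast

lemma vertex_in_cell: "v \<in> e \<Longrightarrow> finite e \<Longrightarrow> (\<lambda>w. if w = v then 1 else 0) \<in> cell e"
  by (auto simp: cell_def)

lemma pl_path_vertices:
  assumes T: "finite_tree T" and "u \<in> verts T" "v \<in> verts T"
  shows "\<exists>l. pl_path T (\<lambda>w. if w = u then 1 else 0) l (\<lambda>w. if w = v then 1 else 0)"
proof -
  have "(u, v) \<in> {(a, b). {a, b} \<in> edges T}\<^sup>*"
    using assms by (auto simp: finite_tree_def graph_connected_def)
  then show ?thesis
  proof (induction rule: rtrancl_induct)
    case base
    have "(\<lambda>w. if w = u then 1 else 0) \<in> points T"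
      using vertex_in_cell[of u "{u}"] assms(2) by (auto simp: points_def)
    then show ?case using pl_path.refl by blast
  next
    case (step y z)
    then obtain l where "pl_path T (\<lambda>w. if w = u then 1 else 0) l (\<lambda>w. if w = y then 1 else 0)"
      by auto
    moreover have "pl_path T (\<lambda>w. if w = y then 1 else 0)
        (edge_dist T {y, z} (\<lambda>w. if w = y then 1 else 0) (\<lambda>w. if w = z then 1 else 0))
        (\<lambda>w. if w = z then 1 else 0)"
      using step(2) by (intro pl_path_edge vertex_in_cell) auto
    ultimately show ?case using pl_path_trans by blast
  qed
qed

lemma pl_path_to_vertex:
  assumes T: "finite_tree T" and x: "x \<in> points T"
  shows "\<exists>v\<in>verts T. \<exists>l. pl_path T x l (\<lambda>w. if w = v then 1 else 0)"
  using x unfolding points_def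
proof (elim UnE UN_E)
  fix v assume v: "v \<in> verts T" "x \<in> cell {v}"
  then have "x = (\<lambda>w. if w = v then 1 else 0)" by (auto simp: cell_def)
  then show ?thesis using pl_path.refl[OF x] v by blast
next
  fix e assume e: "e \<in> edges T" "x \<in> cell e"
  obtain u v where uv: "e = {u, v}" "u \<in> verts T" using edge_cases[OF T e(1)] by metis
  then show ?thesis using pl_path_edge[OF e vertex_in_cell[of u e]] by auto
qed

lemma pl_path_exists:
  assumes "finite_tree T" "x \<in> points T" "y \<in> points T"
  shows "\<exists>l. pl_path T x l y"
proof -
  let ?p = "\<lambda>v w. if w = v then 1 else (0::real)"
  obtain u k where u: "u \<in> verts T" "pl_path T x k (?p u)"
    using pl_path_to_vertex[OF assms(1,2)] by blast
  obtain v m where v: "v \<in> verts T" "pl_path T y m (?p v)"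
    using pl_path_to_vertex[OF assms(1,3)] by blast
  obtain l where "pl_path T (?p u) l (?p v)"
    using pl_path_vertices[OF assms(1) u(1) v(1)] by blast
  from pl_path_trans[OF pl_path_trans[OF u(2) this] pl_path_sym[OF v(2)]] show ?thesis by blast
qed

lemma pl_path_lower_bound:
  assumes T: "finite_tree T" and c: "0 \<le> c" "\<And>e. e \<in> edges T \<Longrightarrow> 2 * c \<le> elen T e"
  shows "pl_path T x l y \<Longrightarrow> c * \<bar>x w - y w\<bar> \<le> l"
proof (induction rule: pl_path.induct)
  case (step e x y l z)
  have fin: "finite e" using edge_cases[OF T step(1)] by (metis finite.simps)
  have "\<bar>x w - y w\<bar> \<le> (\<Sum>v\<in>e. \<bar>x v - y v\<bar>)"
  proof (cases "w \<in> e")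
    case True then show ?thesis using member_le_sum[of w e "\<lambda>v. \<bar>x v - y v\<bar>"] fin by auto
  next
    case False then have "x w = 0" "y w = 0" using step(2,3) by (auto simp: cell_def)
    then show ?thesis by (simp add: sum_nonneg)
  qed
  then have "(2 * c) * (\<bar>x w - y w\<bar> / 2) \<le> edge_dist T e x y"
    unfolding edge_dist_def using c(1) c(2)[OF step(1)] by (intro mult_mono) auto
  moreover have "c * \<bar>x w - z w\<bar> \<le> c * \<bar>x w - y w\<bar> + c * \<bar>y w - z w\<bar>"
    using c(1) by (simp flip: distrib_left add: mult_left_mono)
  ultimately show ?case using step.IH by auto
qed auto

lemma Metric_space_tree:
  assumes T: "finite_tree T"
  shows "Metric_space (points T) (path_dist T)"
proof
  have bdd: "bdd_below {l. pl_path T x l y}" for x y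
    using pl_path_nonneg[OF T] by (auto intro!: bdd_belowI)
  have D: "path_dist T x y = Inf {l. pl_path T x l y}" if "x \<in> points T" "y \<in> points T" for x y
    using that by (simp add: path_dist_def)
  show nonneg: "0 \<le> path_dist T x y" for x y
  proof (cases "x \<in> points T \<and> y \<in> points T")
    case True
    then have "{l. pl_path T x l y} \<noteq> {}" using pl_path_exists[OF T] by blast
    then have "0 \<le> Inf {l. pl_path T x l y}"
      by (rule cInf_greatest) (use pl_path_nonneg[OF T] in blast)
    then show ?thesis using True by (simp add: path_dist_def)
  qed (auto simp: path_dist_def)
  show "path_dist T x y = path_dist T y x" for x y
  proof -
    have "{l. pl_path T x l y} = {l. pl_path T y l x}" using pl_path_sym by blast
    then show ?thesis by (auto simp: path_dist_def)
  qed
  show "path_dist T x y = 0 \<longleftrightarrow> x = y" if xy: "x \<in> points T" "y \<in> points T" for x y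
  proof
    assume "x = y"
    then have "path_dist T x y \<le> 0"
      using xy unfolding path_dist_def using pl_path.refl[OF xy(1)] bdd by (auto intro!: cInf_lower)
    then show "path_dist T x y = 0" using nonneg[of x y] by linarith
  next
    assume 0: "path_dist T x y = 0"
    have "finite (edges T)" 
      using T by (auto simp: finite_tree_def intro: finite_subset[of _ "Pow (verts T)"])
    then obtain c where c: "0 < c" "\<And>e. e \<in> edges T \<Longrightarrow> 2 * c \<le> elen T e"
    proof -
      define m where "m = Min (insert 1 (elen T ` edges T))"
      have "0 < m" "\<And>e. e \<in> edges T \<Longrightarrow> m \<le> elen T e"
        using T \<open>finite (edges T)\<close> by (auto simp: m_def finite_tree_def)
      then show thesis using that[of "m / 2"] by auto
    qed
    have "c * \<bar>x w - y w\<bar> \<le> path_dist T x y" for w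
      unfolding D[OF xy]
      using pl_path_exists[OF T xy] pl_path_lower_bound[OF T _ c(2)] c(1)
      by (intro cInf_greatest) auto
    then show "x = y" using c(1) 0 by (auto simp: fun_eq_iff mult_le_0_iff)
  qed
  show "path_dist T x z \<le> path_dist T x y + path_dist T y z"
    if xyz: "x \<in> points T" "y \<in> points T" "z \<in> points T" for x y z
  proof -
    have "path_dist T x z - l \<le> path_dist T y z" if l: "pl_path T x l y" for l
      unfolding D[OF xyz(2) xyz(3)]
    proof (intro cInf_greatest)
      show "{l. pl_path T y l z} \<noteq> {}" using pl_path_exists[OF T] xyz(2) xyz(3) by auto
      fix l' assume "l' \<in> {l. pl_path T y l z}"
      then have "path_dist T x z \<le> l + l'"
        unfolding D[OF xyz(1) xyz(3)] using pl_path_trans[OF l] bdd by (auto intro!: cInf_lower)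
      then show "path_dist T x z - l \<le> l'" by simp
    qed
    then have "path_dist T x z - path_dist T y z \<le> path_dist T x y"
      unfolding D[OF xyz(1) xyz(2)] using pl_path_exists[OF T] xyz(1) xyz(2)
      by (intro cInf_greatest) (auto simp: algebra_simps)
    then show ?thesis by simp
  qed
qed

abbreviation tree_topology :: "'v weighted_graph \<Rightarrow> ('v \<Rightarrow> real) topology" where
  "tree_topology T \<equiv> Metric_space.mtopology (points T) (path_dist T)"

abbreviation tball :: "'v weighted_graph \<Rightarrow> ('v \<Rightarrow> real) \<Rightarrow> real \<Rightarrow> ('v \<Rightarrow> real) set" where
  "tball T v s \<equiv> Metric_space.mcball (points T) (path_dist T) v s"

definition total_length :: "'v weighted_graph \<Rightarrow> real" where
  "total_length T = (\<Sum>e\<in>edges T. elen T e)"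


section \<open>Borel measures on the tree\<close>

definition borel_of_topology :: "'a topology \<Rightarrow> 'a measure" where
  "borel_of_topology X = sigma (topspace X) {U. openin X U}"

abbreviation tree_borel :: "'v weighted_graph \<Rightarrow> ('v \<Rightarrow> real) measure" where
  "tree_borel T \<equiv> borel_of_topology (tree_topology T)"

text \<open>The point of the edge \<open>{u, v}\<close> at distance \<open>t\<close> from \<open>u\<close>.\<close>

definition edge_point :: "'v weighted_graph \<Rightarrow> 'v \<Rightarrow> 'v \<Rightarrow> real \<Rightarrow> 'v \<Rightarrow> real" where
  "edge_point T u v t =
     (\<lambda>w. if w = u then 1 - t / elen T {u, v} else if w = v then t / elen T {u, v} else 0)"

text \<open>
  The sum runs over oriented edges, so that every edge is counted twice; this accounts for the
  division by 2.
\<close>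

definition length_measure :: "'v weighted_graph \<Rightarrow> ('v \<Rightarrow> real) measure" where
  "length_measure T = measure_of (points T) (sets (tree_borel T))
     (\<lambda>A. (\<Sum>(u, v)\<in>{(u, v). {u, v} \<in> edges T}.
              emeasure lborel {t \<in> {0..elen T {u, v}}. edge_point T u v t \<in> A}) / 2)"

text \<open>
  Maximal \<open>\<sigma>\<close>-mass of a closed ball of radius \<open>s\<close>. For finite \<open>\<sigma>\<close> the mass is upper semicontinuous
  in the centre and the tree is compact, so the supremum is a maximum.
\<close>

definition max_ball_mass :: "'v weighted_graph \<Rightarrow> ('v \<Rightarrow> real) measure \<Rightarrow> real \<Rightarrow> ennreal" where
  "max_ball_mass T \<sigma> s = (SUP v\<in>points T. emeasure \<sigma> (tball T v s))"

definition ball_volume_profile :: "'v weighted_graph \<Rightarrow> real \<Rightarrow> ennreal" where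
  "ball_volume_profile T s = max_ball_mass T (length_measure T) s"


section \<open>Covers, as tuples of radii\<close>

definition covers :: "'v weighted_graph \<Rightarrow> real list set" where
  "covers T = {rs. rs \<noteq> [] \<and> (\<forall>r\<in>set rs. 0 \<le> r) \<and>
     (\<exists>vs. length vs = length rs \<and> set vs \<subseteq> points T \<and>
           points T \<subseteq> (\<Union>i<length rs. tball T (vs ! i) (rs ! i)))}"

definition short_covers :: "'v weighted_graph \<Rightarrow> real list set" where
  "short_covers T = {rs \<in> covers T. sum_list rs \<le> total_length T}"

text \<open>
  The disjoint-union Borel structure on tuples of arbitrary length: a set is measurable iff its
  intersection with the tuples of length \<open>m\<close> is a Borel subset of \<open>\<real>\<^sup>m\<close>, for every \<open>m\<close>.
\<close>

definition tuple_borel :: "real list measure" where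
  "tuple_borel = sigma UNIV
     {A. \<forall>m. {r \<in> space (Pi\<^sub>M {..<m} (\<lambda>_. borel :: real measure)). map r [0..<m] \<in> A}
             \<in> sets (Pi\<^sub>M {..<m} (\<lambda>_. borel))}"

text \<open>Borel measures on \<open>\<real>\<^sub>\<ge>\<^sub>0\<close>, and the extension by zero of a measure on \<open>[0, R]\<close>.\<close>

abbreviation nonneg_borel :: "real measure" where
  "nonneg_borel \<equiv> restrict_space borel {0..}"

definition extend_by_zero :: "real measure \<Rightarrow> real measure" where
  "extend_by_zero \<beta> = distr \<beta> nonneg_borel (\<lambda>s. s)"

definition mark_intensity :: "real list measure \<Rightarrow> real measure" where
  "mark_intensity \<nu> = measure_of {0..} (sets nonneg_borel)
     (\<lambda>A. \<integral>\<^sup>+ rs. of_nat (card {i. i < length rs \<and> rs ! i \<in> A}) \<partial>\<nu>)"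


section \<open>The three conditions on a measure on \<open>[0, R]\<close>\<close>

text \<open>
  Measures are compared by \<open>\<le>\<close> only when they live on the same \<open>\<sigma>\<close>-algebra, here that of
  \<open>nonneg_borel\<close>; the library order then is the setwise one.
\<close>

definition cover_dominated :: "'v weighted_graph \<Rightarrow> real measure \<Rightarrow> bool" where
  "cover_dominated T \<beta> \<longleftrightarrow>
     (\<exists>\<nu>. prob_space \<nu> \<and> sets \<nu> = sets (restrict_space tuple_borel (short_covers T)) \<and>
          mark_intensity \<nu> \<le> extend_by_zero \<beta>)"

definition fractional_marked_ball_cover ::
    "'v weighted_graph \<Rightarrow> real \<Rightarrow> (('v \<Rightarrow> real) \<times> real) measure \<Rightarrow> bool" where
  "fractional_marked_ball_cover T R \<xi> \<longleftrightarrow>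
     finite_measure \<xi> \<and>
     sets \<xi> = sets (borel_of_topology (prod_topology (tree_topology T) (top_of_set {0..R}))) \<and>
     (\<forall>x\<in>points T. 1 \<le> emeasure \<xi> {(v, s) \<in> points T \<times> {0..R}. path_dist T x v \<le> s})"

definition fractionally_dominated :: "'v weighted_graph \<Rightarrow> real \<Rightarrow> real measure \<Rightarrow> bool" where
  "fractionally_dominated T R \<beta> \<longleftrightarrow>
     (\<exists>\<xi>. fractional_marked_ball_cover T R \<xi> \<and> distr \<xi> nonneg_borel snd \<le> extend_by_zero \<beta>)"

definition ball_mass_condition :: "'v weighted_graph \<Rightarrow> real measure \<Rightarrow> bool" where
  "ball_mass_condition T \<beta> \<longleftrightarrow>
     (\<forall>\<sigma>. finite_measure \<sigma> \<and> sets \<sigma> = sets (tree_borel T) \<longrightarrow>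
          emeasure \<sigma> (points T) \<le> (\<integral>\<^sup>+ s. max_ball_mass T \<sigma> s \<partial>\<beta>))"

end

theory Submission
  imports Defs
begin

text \<open>
  Of the three conditions, the dual one, \<open>ball_mass_condition\<close>, is the one that can be tested
  against measures, and both conclusions are instances of it. Testing it with the length measure
  gives (i), because the total mass is the total length and the maximal ball mass is by definition the
  volume profile. Testing it with the counting measure on a \<open>\<delta>\<close>-separated set of \<open>m\<close> points gives (ii):
  a closed ball of radius less than \<open>\<delta> / 2\<close> has diameter less than \<open>\<delta>\<close>, so it has mass at most 1,
  and every other ball has mass at most \<open>m\<close>.

  It remains to see that each of the other two conditions implies this one. Let \<open>\<sigma>\<close> be a finite
  measure on the tree and \<open>M s\<close> the maximal \<open>\<sigma>\<close>-mass of a ball of radius \<open>s\<close>. For a random cover,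
  subadditivity gives \<open>\<sigma>(T) \<le> M r\<^sub>1 + \<dots> + M r\<^sub>k\<close> for each cover, and the mean of the right-hand side is
  the integral of \<open>M\<close> against the intensity (\<open>cover_imp_ball_mass_condition\<close>, with the Campbell formula
  \<open>nn_integral_mark_intensity\<close>). For a fractional cover \<open>\<xi>\<close>, every point \<open>x\<close> is covered by marked balls
  of total \<open>\<xi>\<close>-mass at least 1; integrating this over \<open>\<sigma>\<close> and exchanging the order of integration
  turns it into a \<open>\<xi>\<close>-integral of ball masses, which \<open>M\<close> dominates
  (\<open>fractional_imp_ball_mass_condition\<close>). In both cases the marginal on radii is dominated by \<open>\<beta>\<close>.

  The measure-theoretic work behind this is that \<open>M\<close> is Borel, being monotone; that the incidence
  relation between points and marked balls lies in the product \<open>\<sigma>\<close>-algebra, which uses the separability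
  of the tree; and that the length measure and the intensity are countably additive, so that their
  values are those given by their defining formulas.
\<close>

section \<open>Borel sets of a topology\<close>

lemma openin_family_subset_Pow: "{U. openin X U} \<subseteq> Pow (topspace X)"
  by (auto dest: openin_subset)

lemma space_borel_of_topology [simp]: "space (borel_of_topology X) = topspace X"
  using openin_family_subset_Pow[of X] by (simp add: borel_of_topology_def space_measure_of)

lemma openin_borel_of_topology: "openin X U \<Longrightarrow> U \<in> sets (borel_of_topology X)"
  using openin_family_subset_Pow[of X] by (simp add: borel_of_topology_def sigma_sets.Basic)

lemma closedin_borel_of_topology:
  assumes "closedin X C" shows "C \<in> sets (borel_of_topology X)"
proof -
  have "topspace X - C \<in> sets (borel_of_topology X)"
    using assms by (intro openin_borel_of_topology) auto
  from sets.compl_sets[OF this] show ?thesis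
    using closedin_subset[OF assms] by (simp add: double_diff)
qed

lemma continuous_map_measurable_borel_of_topology:
  assumes "continuous_map X Y f"
  shows "f \<in> measurable (borel_of_topology X) (borel_of_topology Y)"
  unfolding borel_of_topology_def[of Y]
proof (rule measurable_measure_of[OF openin_family_subset_Pow])
  show "f \<in> space (borel_of_topology X) \<rightarrow> topspace Y"
    using continuous_map_funspace[OF assms] by simp
  fix U assume "U \<in> {U. openin Y U}"
  then have "openin X {x \<in> topspace X. f x \<in> U}"
    using openin_continuous_map_preimage[OF assms] by blast
  then show "f -` U \<inter> space (borel_of_topology X) \<in> sets (borel_of_topology X)"
    by (auto dest!: openin_borel_of_topology simp: vimage_def Int_def conj_commute)
qed

lemma borel_of_topology_euclidean:
  "borel_of_topology (euclidean :: 'a::topological_space topology) = borel"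
  by (simp add: borel_of_topology_def borel_def)

lemma continuous_map_top_of_set_measurable:
  fixes S :: "'a::topological_space set"
  assumes "continuous_map (top_of_set S) Y f"
  shows "f \<in> measurable (restrict_space borel S) (borel_of_topology Y)"
  unfolding borel_of_topology_def
proof (rule measurable_measure_of[OF openin_family_subset_Pow])
  show "f \<in> space (restrict_space borel S) \<rightarrow> topspace Y"
    using continuous_map_funspace[OF assms] by (simp add: space_restrict_space)
  fix U assume "U \<in> {U. openin Y U}"
  then have "openin (top_of_set S) {x \<in> S. f x \<in> U}"
    using openin_continuous_map_preimage[OF assms] by fastforce
  then obtain V where V: "open V" "{x \<in> S. f x \<in> U} = S \<inter> V" by (auto simp: openin_open)
  then have "f -` U \<inter> space (restrict_space borel S) = S \<inter> V"
    by (auto simp: space_restrict_space)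
  then show "f -` U \<inter> space (restrict_space borel S) \<in> sets (restrict_space borel S)"
    using V(1) by (auto simp: sets_restrict_space)
qed

lemma borel_measurable_mono_ennreal:
  fixes f :: "real \<Rightarrow> ennreal"
  assumes "mono f" shows "f \<in> borel_measurable borel"
proof (rule borel_measurableI_greater)
  fix y
  have "is_interval {x. y < f x}"
    unfolding is_interval_1 using less_le_trans monoD[OF assms] by blast
  then show "{x \<in> space borel. y < f x} \<in> sets borel"
    by (simp add: real_interval_borel_measurable)
qed

text \<open>
  In general the Borel \<open>\<sigma>\<close>-algebra of a product of spaces is larger than the product of the Borel
  \<open>\<sigma>\<close>-algebras, so that closedness of the set does not suffice. A countable dense set \<open>D\<close> removes the
  problem: \<open>d x y\<close> is the infimum of \<open>d q x + d q y\<close> over \<open>q \<in> D\<close>, and each of these sums is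
  measurable for the product \<open>\<sigma>\<close>-algebra because it separates the two variables.
\<close>

lemma (in Metric_space) dist_le_sets_pair:
  assumes D: "countable D" "D \<subseteq> M"
    and dense: "\<And>x e. x \<in> M \<Longrightarrow> 0 < e \<Longrightarrow> \<exists>q\<in>D. d x q < e"
    and B: "sets A = sets (borel_of_topology mtopology)"
    and f: "f \<in> measurable N (borel_of_topology mtopology)" and g: "g \<in> borel_measurable N"
  shows "{(x, p). x \<in> M \<and> p \<in> space N \<and> d x (f p) \<le> g p} \<in> sets (A \<Otimes>\<^sub>M N)"
proof -
  have spA: "space A = M" using sets_eq_imp_space_eq[OF B] by simp
  have fM: "f p \<in> M" if "p \<in> space N" for p
    using measurable_space[OF f that] by simp
  have dA: "d q \<in> borel_measurable A" if "q \<in> M" for q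
  proof -
    have "continuous_map mtopology euclidean (mdist (metric (M, d)) q)"
      using continuous_on_mdist[of q "metric (M, d)"] that by simp
    from continuous_map_measurable_borel_of_topology[OF this]
    show ?thesis by (simp add: borel_of_topology_euclidean measurable_cong_sets[OF B HOL.refl])
  qed
  have dN: "(\<lambda>p. d q (f p)) \<in> borel_measurable N" if "q \<in> M" for q
    using measurable_compose[OF f] dA[OF that] by (simp add: measurable_cong_sets[OF B HOL.refl])
  \<comment> \<open>The infimum over \<open>D\<close> need not be attained, hence the slack \<open>1 / Suc n\<close>.\<close>
  have iff: "d x (f p) \<le> g p \<longleftrightarrow> (\<forall>n. \<exists>q\<in>D. d q x + d q (f p) \<le> g p + 1 / real (Suc n))"
    if x: "x \<in> M" and p: "p \<in> space N" for x p
  proof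
    assume le: "d x (f p) \<le> g p"
    show "\<forall>n. \<exists>q\<in>D. d q x + d q (f p) \<le> g p + 1 / real (Suc n)"
    proof
      fix n
      define e where "e = 1 / real (Suc n)"
      obtain q where q: "q \<in> D" "d x q < e / 2"
        using dense[OF x, of "e / 2"] by (auto simp: e_def)
      have "d q (f p) \<le> d q x + d x (f p)"
        using q D x p fM by (intro triangle) auto
      then have "d q x + d q (f p) \<le> g p + e"
        using q le commute[of q x] by linarith
      then show "\<exists>q\<in>D. d q x + d q (f p) \<le> g p + 1 / real (Suc n)"
        using q by (auto simp: e_def)
    qed
  next
    assume *: "\<forall>n. \<exists>q\<in>D. d q x + d q (f p) \<le> g p + 1 / real (Suc n)"
    show "d x (f p) \<le> g p"
    proof (rule field_le_epsilon)
      fix e :: real assume "0 < e"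
      then obtain n where n: "1 / real (Suc n) < e" using nat_approx_posE by blast
      obtain q where q: "q \<in> D" "d q x + d q (f p) \<le> g p + 1 / real (Suc n)" using * by blast
      have "d x (f p) \<le> d x q + d q (f p)"
        using q D x p fM by (intro triangle) auto
      then show "d x (f p) \<le> g p + e" using q n commute[of q x] by linarith
    qed
  qed
  have "{(x, p). x \<in> M \<and> p \<in> space N \<and> d x (f p) \<le> g p} =
    {z \<in> space (A \<Otimes>\<^sub>M N). \<forall>n. \<exists>q\<in>D. d q (fst z) + d q (f (snd z)) \<le> g (snd z) + 1 / real (Suc n)}"
    using iff by (auto simp: space_pair_measure spA)
  also have "\<dots> \<in> sets (A \<Otimes>\<^sub>M N)"
  proof (intro sets.sets_Collect_countable_All sets.sets_Collect_countable_Ex' D borel_measurable_le)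
    fix q assume "q \<in> D"
    then have q: "q \<in> M" using D by auto
    have [measurable]: "d q \<in> borel_measurable A" "(\<lambda>p. d q (f p)) \<in> borel_measurable N"
      "g \<in> borel_measurable N"
      using dA[OF q] dN[OF q] g by auto
    show "(\<lambda>z. d q (fst z) + d q (f (snd z))) \<in> borel_measurable (A \<Otimes>\<^sub>M N)"
      by measurable
    show "(\<lambda>z. g (snd z) + 1 / real (Suc n)) \<in> borel_measurable (A \<Otimes>\<^sub>M N)" for n
      by measurable
  qed
  finally show ?thesis .
qed


section \<open>Parametrization of the edges by arc length\<close>

lemma edge_point_in_cell:
  assumes "u \<noteq> v" "0 < elen T {u, v}" "t \<in> {0..elen T {u, v}}"
  shows "edge_point T u v t \<in> cell {u, v}"
  using assms by (auto simp: cell_def edge_point_def)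

lemma cell_edge_point:
  assumes "u \<noteq> v" "0 < elen T {u, v}" "x \<in> cell {u, v}"
  obtains t where "t \<in> {0..elen T {u, v}}" "x = edge_point T u v t"
proof
  have sum: "x u + x v = 1" and nn: "0 \<le> x u" "0 \<le> x v"
    and z: "\<And>w. w \<noteq> u \<Longrightarrow> w \<noteq> v \<Longrightarrow> x w = 0"
    using assms(1,3) by (auto simp: cell_def)
  \<comment> \<open>The barycentric coordinate of the far endpoint \<open>v\<close> is the fraction of the edge traversed from \<open>u\<close>.\<close>
  show "x v * elen T {u, v} \<in> {0..elen T {u, v}}"
    using sum nn assms(2) by (auto intro: mult_left_le_one_le)
  show "x = edge_point T u v (x v * elen T {u, v})"
    using sum z assms(1,2) by (auto simp: edge_point_def fun_eq_iff)
qed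

lemma edge_dist_edge_point:
  assumes "u \<noteq> v" "0 < elen T {u, v}"
  shows "edge_dist T {u, v} (edge_point T u v s) (edge_point T u v t) = \<bar>s - t\<bar>"
proof -
  let ?l = "elen T {u, v}"
  have "(1 - s / ?l) - (1 - t / ?l) = - ((s - t) / ?l)" "s / ?l - t / ?l = (s - t) / ?l"
    by (simp_all add: diff_divide_distrib)
  then have "\<bar>(1 - s / ?l) - (1 - t / ?l)\<bar> = \<bar>s - t\<bar> / ?l" "\<bar>s / ?l - t / ?l\<bar> = \<bar>s - t\<bar> / ?l"
    using assms(2) by (simp_all only: abs_minus_cancel abs_divide abs_of_pos)
  then show ?thesis using assms
    by (simp only: edge_dist_def edge_point_def) simp
qed

lemma path_dist_le:
  assumes "finite_tree T" "pl_path T x l y" "x \<in> points T" "y \<in> points T"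
  shows "path_dist T x y \<le> l"
  unfolding path_dist_def using assms pl_path_nonneg[OF assms(1)]
  by (auto intro!: cInf_lower bdd_belowI)

lemma edge_endpoints:
  assumes "finite_tree T" "{u, v} \<in> edges T"
  shows "u \<noteq> v" "u \<in> verts T" "v \<in> verts T" "0 < elen T {u, v}"
  using edge_cases[OF assms] assms by (auto simp: finite_tree_def doubleton_eq_iff)

text \<open>
  The edge itself is an admissible path, so the parametrization is 1-Lipschitz. Continuity of the
  parametrization and separability of the tree both come from this bound.
\<close>

lemma path_dist_edge_point_le:
  assumes T: "finite_tree T" and e: "{u, v} \<in> edges T"
    and st: "s \<in> {0..elen T {u, v}}" "t \<in> {0..elen T {u, v}}"
  shows "path_dist T (edge_point T u v s) (edge_point T u v t) \<le> \<bar>s - t\<bar>"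
proof -
  note uv = edge_endpoints[OF T e]
  note c = edge_point_in_cell[OF uv(1) uv(4) st(1)] edge_point_in_cell[OF uv(1) uv(4) st(2)]
  from pl_path_edge[OF e c] show ?thesis
    using path_dist_le[OF T] c cell_subset_points[OF e] edge_dist_edge_point[OF uv(1,4)] by auto
qed

lemma continuous_map_edge_point:
  assumes T: "finite_tree T" and e: "{u, v} \<in> edges T"
  shows "continuous_map (top_of_set {0..elen T {u, v}}) (tree_topology T) (edge_point T u v)"
proof -
  interpret Metric_space "points T" "path_dist T" by (rule Metric_space_tree[OF T])
  note uv = edge_endpoints[OF T e]
  have in_points: "edge_point T u v t \<in> points T" if "t \<in> {0..elen T {u, v}}" for t
    using edge_point_in_cell[OF uv(1,4) that] cell_subset_points[OF e] by auto
  show ?thesis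
    unfolding continuous_map_to_metric
  proof (intro ballI allI impI)
    fix t and \<epsilon> :: real
    assume t: "t \<in> topspace (top_of_set {0..elen T {u, v}})" and "0 < \<epsilon>"
    have "edge_point T u v s \<in> mball (edge_point T u v t) \<epsilon>"
      if "s \<in> {0..elen T {u, v}} \<inter> ball t \<epsilon>" for s
      using path_dist_edge_point_le[OF T e, of t s] that t in_points by (auto simp: dist_real_def)
    moreover have "openin (top_of_set {0..elen T {u, v}}) ({0..elen T {u, v}} \<inter> ball t \<epsilon>)"
      by (simp add: openin_open_Int)
    ultimately show "\<exists>U. openin (top_of_set {0..elen T {u, v}}) U \<and> t \<in> U \<and>
        (\<forall>y\<in>U. edge_point T u v y \<in> mball (edge_point T u v t) \<epsilon>)"
      using t \<open>0 < \<epsilon>\<close> by (intro exI[of _ "{0..elen T {u, v}} \<inter> ball t \<epsilon>"]) auto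
  qed
qed

lemma finite_oriented_edges:
  assumes "finite_tree T" shows "finite {(u, v). {u, v} \<in> edges T}"
proof (rule finite_subset)
  show "{(u, v). {u, v} \<in> edges T} \<subseteq> verts T \<times> verts T"
    using edge_endpoints[OF assms] by auto
  show "finite (verts T \<times> verts T)" using assms by (auto simp: finite_tree_def)
qed

text \<open>
The points at rational distance from an endpoint of an edge are dense, by the Lipschitz bound.
\<close>

lemma tree_separable:
  assumes T: "finite_tree T"
  obtains D where "countable D" "D \<subseteq> points T"
    "\<And>x e. x \<in> points T \<Longrightarrow> 0 < e \<Longrightarrow> \<exists>q\<in>D. path_dist T x q < e"
proof
  interpret Metric_space "points T" "path_dist T" by (rule Metric_space_tree[OF T])
  define I where "I = (\<lambda>(u, v). {0..elen T {u, v}} \<inter> \<rat>)"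
  define D where "D = (\<Union>v\<in>verts T. cell {v}) \<union>
    (\<Union>p\<in>{(u, v). {u, v} \<in> edges T}. case_prod (edge_point T) p ` I p)"
  have "cell {v} = {\<lambda>w. if w = v then 1 else 0}" for v :: 'a
    by (auto simp: cell_def)
  moreover have "countable (verts T)" using T by (auto simp: finite_tree_def countable_finite)
  moreover have "countable (I p)" for p
    using countable_rat by (auto simp: I_def split: prod.split)
  ultimately show "countable D"
    unfolding D_def using finite_oriented_edges[OF T]
    by (intro countable_Un countable_UN countable_image countable_finite[of "{(u, v). {u, v} \<in> edges T}"]) auto
  show "D \<subseteq> points T"
  proof
    fix x assume "x \<in> D"
    then consider v where "v \<in> verts T" "x \<in> cell {v}"
      | u v t where "{u, v} \<in> edges T" "t \<in> {0..elen T {u, v}}" "x = edge_point T u v t"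
      by (auto simp: D_def I_def)
    then show "x \<in> points T"
    proof cases
      case 1
      then show ?thesis by (auto simp: points_def)
    next
      case 2
      then show ?thesis
        using edge_point_in_cell[OF edge_endpoints(1,4)[OF T 2(1)]] cell_subset_points[OF 2(1)] by auto
    qed
  qed
  show "\<exists>q\<in>D. path_dist T x q < \<epsilon>" if x: "x \<in> points T" and \<epsilon>: "0 < \<epsilon>" for x \<epsilon>
    using x unfolding points_def
  proof (elim UnE UN_E)
    fix v assume "v \<in> verts T" "x \<in> cell {v}"
    then show ?thesis using x \<epsilon> by (intro bexI[of _ x]) (auto simp: D_def)
  next
    fix e assume e: "e \<in> edges T" "x \<in> cell e"
    obtain u v where uv: "e = {u, v}" using edge_cases[OF T e(1)] by metis
    note uv' = edge_endpoints[OF T e(1)[unfolded uv]]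
    obtain t where t: "t \<in> {0..elen T {u, v}}" "x = edge_point T u v t"
      using cell_edge_point[OF uv'(1,4)] e uv by metis
    \<comment> \<open>Approximating \<open>t\<close> from below keeps \<open>q\<close> in the edge; at \<open>t = 0\<close> there is no room, but 0 is rational.\<close>
    obtain q where q: "q \<in> {0..elen T {u, v}}" "q \<in> \<rat>" "\<bar>t - q\<bar> < \<epsilon>"
    proof (cases "t = 0")
      case True
      then show ?thesis using that[of 0] uv'(4) \<epsilon> by auto
    next
      case False
      then obtain q where "q \<in> \<rat>" "max 0 (t - \<epsilon>) < q" "q < t"
        using Rats_dense_in_real[of "max 0 (t - \<epsilon>)" t] t \<epsilon> by auto
      then show ?thesis using that[of q] t by auto
    qed
    have "path_dist T x (edge_point T u v q) < \<epsilon>"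
      using path_dist_edge_point_le[OF T e(1)[unfolded uv] t(1) q(1)] t q by auto
    moreover have "edge_point T u v q \<in> D" using e uv q by (force simp: D_def I_def)
    ultimately show ?thesis by blast
  qed
qed

section \<open>Ball masses\<close>

lemma space_tree_borel: "finite_tree T \<Longrightarrow> space (tree_borel T) = points T"
  by (simp add: Metric_space.topspace_mtopology[OF Metric_space_tree])

lemma tball_in_sets: "finite_tree T \<Longrightarrow> tball T v s \<in> sets (tree_borel T)"
  by (intro closedin_borel_of_topology Metric_space.closedin_mcball[OF Metric_space_tree])

lemma emeasure_tball_le_max_ball_mass:
  assumes "v \<in> points T" shows "emeasure \<sigma> (tball T v s) \<le> max_ball_mass T \<sigma> s"
  unfolding max_ball_mass_def using assms by (intro SUP_upper)

text \<open>
  A supremum over the uncountably many centres need not be measurable in general. Here it is a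
  monotone function of the radius; it vanishes at negative radii, where balls are empty.
\<close>

lemma max_ball_mass_measurable:
  assumes T: "finite_tree T" and \<sigma>: "sets \<sigma> = sets (tree_borel T)"
  shows "max_ball_mass T \<sigma> \<in> borel_measurable borel"
proof (intro borel_measurable_mono_ennreal monoI)
  fix s t :: real assume "s \<le> t"
  then show "max_ball_mass T \<sigma> s \<le> max_ball_mass T \<sigma> t"
    unfolding max_ball_mass_def
    by (intro SUP_mono' emeasure_mono Metric_space.mcball_subset_concentric[OF Metric_space_tree[OF T]])
      (simp_all only: \<sigma> tball_in_sets[OF T])
qed

lemma nn_integral_extend_by_zero:
  assumes \<beta>: "sets \<beta> = sets (restrict_space borel {0..R})" and g: "g \<in> borel_measurable borel"
  shows "(\<integral>\<^sup>+ s. g s \<partial>extend_by_zero \<beta>) = (\<integral>\<^sup>+ s. g s \<partial>\<beta>)"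
  unfolding extend_by_zero_def
proof (rule nn_integral_distr)
  have "(\<lambda>s::real. s) \<in> measurable (restrict_space borel {0..R}) (restrict_space borel {0..})"
    by (intro measurable_restrict_space2 measurable_restrict_space1) (auto simp: space_restrict_space)
  then show "(\<lambda>s. s) \<in> measurable \<beta> nonneg_borel"
    by (simp add: measurable_cong_sets[OF \<beta> HOL.refl])
  show "g \<in> borel_measurable (distr \<beta> nonneg_borel (\<lambda>s. s))"
    using g by (simp add: measurable_restrict_space1)
qed

section \<open>Fractional covers\<close>

text \<open>
  Weak duality for the covering problem: the incidence set \<open>G\<close> of points and marked balls is measured by
  \<open>\<sigma> \<otimes> \<xi>\<close> in two ways. Its sections over points have \<open>\<xi>\<close>-mass at least 1, since \<open>\<xi>\<close> covers; its
  sections over marked balls are the balls, whose \<open>\<sigma>\<close>-mass is at most the maximal one.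
\<close>

lemma fractional_imp_ball_mass_condition:
  assumes T: "finite_tree T" and \<beta>: "sets \<beta> = sets (restrict_space borel {0..R})"
    and "fractionally_dominated T R \<beta>"
  shows "ball_mass_condition T \<beta>"
  unfolding ball_mass_condition_def
proof (intro allI impI, elim conjE)
  fix \<sigma> assume "finite_measure \<sigma>" and \<sigma>: "sets \<sigma> = sets (tree_borel T)"
  interpret Metric_space "points T" "path_dist T" by (rule Metric_space_tree[OF T])
  interpret \<sigma>: finite_measure \<sigma> by fact
  let ?X = "prod_topology (tree_topology T) (top_of_set {0..R})"
  obtain \<xi> where \<xi>: "finite_measure \<xi>" "sets \<xi> = sets (borel_of_topology ?X)"
    and cov: "\<And>x. x \<in> points T \<Longrightarrow>
        1 \<le> emeasure \<xi> {(v, s) \<in> points T \<times> {0..R}. path_dist T x v \<le> s}"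
    and dom: "distr \<xi> nonneg_borel snd \<le> extend_by_zero \<beta>"
    using assms(3) unfolding fractionally_dominated_def fractional_marked_ball_cover_def by blast
  interpret \<xi>: finite_measure \<xi> by fact
  interpret pair_sigma_finite \<sigma> \<xi> ..
  have sp: "space \<sigma> = points T" "space \<xi> = points T \<times> {0..R}"
    using sets_eq_imp_space_eq[OF \<sigma>] sets_eq_imp_space_eq[OF \<xi>(2)] by simp_all
  have fst: "fst \<in> measurable \<xi> (tree_borel T)"
    using continuous_map_measurable_borel_of_topology[OF continuous_map_fst]
    by (simp add: measurable_cong_sets[OF \<xi>(2) HOL.refl])
  have "continuous_map ?X euclideanreal snd"
    using continuous_map_snd continuous_map_into_fulltopology by blast
  then have snd: "snd \<in> borel_measurable \<xi>"
    using continuous_map_measurable_borel_of_topology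
    by (fastforce simp: measurable_cong_sets[OF \<xi>(2) HOL.refl] borel_of_topology_euclidean)
  then have snd': "snd \<in> measurable \<xi> nonneg_borel"
    by (intro measurable_restrict_space2) (auto simp: sp)
  note M = max_ball_mass_measurable[OF T \<sigma>]
  define G where
    "G = {(x, p). x \<in> points T \<and> p \<in> space \<xi> \<and> path_dist T x (fst p) \<le> snd p}"
  obtain D where D: "countable D" "D \<subseteq> points T"
      "\<And>x e. x \<in> points T \<Longrightarrow> 0 < e \<Longrightarrow> \<exists>q\<in>D. path_dist T x q < e"
    using tree_separable[OF T] by blast
  have G: "G \<in> sets (\<sigma> \<Otimes>\<^sub>M \<xi>)"
    unfolding G_def by (rule dist_le_sets_pair[OF D \<sigma> fst snd])
  have "emeasure \<sigma> (points T) = (\<integral>\<^sup>+ x. 1 \<partial>\<sigma>)" by (simp add: sp)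
  also have "\<dots> \<le> (\<integral>\<^sup>+ x. emeasure \<xi> (Pair x -` G) \<partial>\<sigma>)"
  proof (rule nn_integral_mono)
    fix x assume "x \<in> space \<sigma>"
    then have "Pair x -` G = {(v, s) \<in> points T \<times> {0..R}. path_dist T x v \<le> s}"
      by (auto simp: G_def sp)
    then show "1 \<le> emeasure \<xi> (Pair x -` G)" using cov \<open>x \<in> space \<sigma>\<close> sp by simp
  qed
  also have "\<dots> = (\<integral>\<^sup>+ p. emeasure \<sigma> ((\<lambda>x. (x, p)) -` G) \<partial>\<xi>)"
    using emeasure_pair_measure_alt2[OF G] \<xi>.emeasure_pair_measure_alt[OF G] by simp
  also have "\<dots> \<le> (\<integral>\<^sup>+ p. max_ball_mass T \<sigma> (snd p) \<partial>\<xi>)"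
  proof (rule nn_integral_mono)
    fix p assume p: "p \<in> space \<xi>"
    have "(\<lambda>x. (x, p)) -` G = tball T (fst p) (snd p)"
      using p by (auto simp: G_def sp commute)
    then show "emeasure \<sigma> ((\<lambda>x. (x, p)) -` G) \<le> max_ball_mass T \<sigma> (snd p)"
      using emeasure_tball_le_max_ball_mass[of "fst p" T] p sp by auto
  qed
  also have "\<dots> = (\<integral>\<^sup>+ s. max_ball_mass T \<sigma> s \<partial>distr \<xi> nonneg_borel snd)"
    using snd' M by (intro nn_integral_distr[symmetric]) (simp_all add: measurable_restrict_space1)
  also have "\<dots> \<le> (\<integral>\<^sup>+ s. max_ball_mass T \<sigma> s \<partial>extend_by_zero \<beta>)"
    using dom by (intro nn_integral_mono_measure) (simp_all add: extend_by_zero_def)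
  also have "\<dots> = (\<integral>\<^sup>+ s. max_ball_mass T \<sigma> s \<partial>\<beta>)"
    by (rule nn_integral_extend_by_zero[OF \<beta> M])
  finally show "emeasure \<sigma> (points T) \<le> (\<integral>\<^sup>+ s. max_ball_mass T \<sigma> s \<partial>\<beta>)" .
qed

section \<open>The intensity of a random cover\<close>

lemma sum_list_measurable_tuple_borel:
  fixes g :: "real \<Rightarrow> ennreal"
  assumes [measurable]: "g \<in> borel_measurable borel"
  shows "(\<lambda>rs. sum_list (map g rs)) \<in> borel_measurable tuple_borel"
proof (rule measurableI)
  fix B :: "ennreal set" assume [measurable]: "B \<in> sets borel"
  let ?A = "(\<lambda>rs. sum_list (map g rs)) -` B"
  have "{r \<in> space (Pi\<^sub>M {..<m} (\<lambda>_. borel)). map r [0..<m] \<in> ?A} \<in> sets (Pi\<^sub>M {..<m} (\<lambda>_. borel))" for m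
  proof -
    have "sum_list (map g (map r [0..<m])) = (\<Sum>i<m. g (r i))" for r
      by (simp add: interv_sum_list_conv_sum_set_nat comp_def atLeast0LessThan)
    moreover have "{r \<in> space (Pi\<^sub>M {..<m} (\<lambda>_. borel)). (\<Sum>i<m. g (r i)) \<in> B}
        \<in> sets (Pi\<^sub>M {..<m} (\<lambda>_. borel))"
      by measurable
    ultimately show ?thesis by (simp del: map_map)
  qed
  then show "?A \<inter> space tuple_borel \<in> sets tuple_borel"
    unfolding tuple_borel_def by (auto intro: sigma_sets.Basic)
qed simp

text \<open>
  Rewriting the number of hits as a sum of indicators makes the intensity formula the special case of
  integrating indicators in the Campbell formula below.
\<close>

lemma card_indices_eq_sum_list:
  "of_nat (card {i. i < length rs \<and> rs ! i \<in> A}) = (sum_list (map (indicator A) rs) :: ennreal)"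
proof -
  have "of_nat (length (filter (\<lambda>r. r \<in> A) rs)) = (sum_list (map (indicator A) rs) :: ennreal)"
    by (induction rs) auto
  then show ?thesis by (simp add: length_filter_conv_card)
qed

lemma suminf_sum_list_indicator:
  fixes A :: "nat \<Rightarrow> 'a set"
  assumes "disjoint_family A"
  shows "(\<Sum>n. sum_list (map (indicator (A n)) rs)) = (sum_list (map (indicator (\<Union>n. A n)) rs) :: ennreal)"
proof (induction rs)
  case (Cons r rs)
  then show ?case
    by (simp add: suminf_add[symmetric] summableI suminf_indicator[OF assms])
qed simp

lemma sets_mark_intensity [simp]: "sets (mark_intensity \<nu>) = sets nonneg_borel"
  unfolding mark_intensity_def
  using sets.sigma_sets_eq[of nonneg_borel] sets.space_closed[of nonneg_borel]
  by (simp add: space_restrict_space)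

text \<open>
  The intensity is declared by a formula on sets, which is its value only once countable additivity is
  known; that follows from monotone convergence for series under the \<open>\<nu>\<close>-integral.
\<close>

lemma emeasure_mark_intensity:
  assumes \<nu>: "sets \<nu> = sets (restrict_space tuple_borel S)" and A: "A \<in> sets nonneg_borel"
  shows "emeasure (mark_intensity \<nu>) A = (\<integral>\<^sup>+ rs. sum_list (map (indicator A) rs) \<partial>\<nu>)"
proof -
  have meas: "(\<lambda>rs. sum_list (map (indicator B) rs) :: ennreal) \<in> borel_measurable \<nu>"
    if "B \<in> sets nonneg_borel" for B
  proof -
    have "B \<in> sets borel" using that by (auto simp: sets_restrict_space)
    then show ?thesis
      using measurable_restrict_space1[OF sum_list_measurable_tuple_borel, of "indicator B" S]
      by (simp add: measurable_cong_sets[OF \<nu> HOL.refl])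
  qed
  have "emeasure (mark_intensity \<nu>) A
      = (\<integral>\<^sup>+ rs. of_nat (card {i. i < length rs \<and> rs ! i \<in> A}) \<partial>\<nu>)"
  proof (rule emeasure_measure_of[OF mark_intensity_def])
    show "sets nonneg_borel \<subseteq> Pow {0..}"
      using sets.space_closed[of nonneg_borel] by (simp add: space_restrict_space)
    show "A \<in> sets (mark_intensity \<nu>)" using A by simp
    show "positive (sets (mark_intensity \<nu>))
        (\<lambda>A. \<integral>\<^sup>+ rs. of_nat (card {i. i < length rs \<and> rs ! i \<in> A}) \<partial>\<nu>)"
      by (simp add: positive_def)
    show "countably_additive (sets (mark_intensity \<nu>))
        (\<lambda>A. \<integral>\<^sup>+ rs. of_nat (card {i. i < length rs \<and> rs ! i \<in> A}) \<partial>\<nu>)"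
      unfolding card_indices_eq_sum_list
    proof (rule countably_additiveI)
      fix B :: "nat \<Rightarrow> real set"
      assume B: "range B \<subseteq> sets (mark_intensity \<nu>)" "disjoint_family B"
      have "(\<Sum>n. \<integral>\<^sup>+ rs. sum_list (map (indicator (B n)) rs) \<partial>\<nu>)
          = (\<integral>\<^sup>+ rs. (\<Sum>n. sum_list (map (indicator (B n)) rs)) \<partial>\<nu>)"
        using B(1) by (intro nn_integral_suminf[symmetric] meas) auto
      then show "(\<Sum>n. \<integral>\<^sup>+ rs. sum_list (map (indicator (B n)) rs) \<partial>\<nu>)
          = (\<integral>\<^sup>+ rs. sum_list (map (indicator (\<Union>n. B n)) rs) \<partial>\<nu>)"
        by (simp add: suminf_sum_list_indicator[OF B(2)])
    qed
  qed
  then show ?thesis by (simp only: card_indices_eq_sum_list)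
qed

text \<open>
  Campbell's formula: integrating \<open>g\<close> against the intensity is averaging the sum of \<open>g\<close> over the entries
  of the random tuple. For indicators it is the definition of the intensity, and both sides are linear and
  continuous along increasing sequences. The intensity lives on the half-line while \<open>g\<close> is Borel on the
  whole line; the two sides agree because the entries of the tuples in \<open>S\<close> are nonnegative.
\<close>

lemma nn_integral_mark_intensity:
  assumes \<nu>: "sets \<nu> = sets (restrict_space tuple_borel S)"
    and S: "\<And>rs r. rs \<in> S \<Longrightarrow> r \<in> set rs \<Longrightarrow> 0 \<le> r"
    and g: "g \<in> borel_measurable borel"
  shows "(\<integral>\<^sup>+ s. g s \<partial>mark_intensity \<nu>) = (\<integral>\<^sup>+ rs. sum_list (map g rs) \<partial>\<nu>)"
proof -
  have I: "h \<in> borel_measurable (mark_intensity \<nu>)" if "h \<in> borel_measurable borel" for h :: "real \<Rightarrow> ennreal"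
    using measurable_restrict_space1[OF that] by (simp add: measurable_cong_sets[OF sets_mark_intensity HOL.refl])
  have J: "(\<lambda>rs. sum_list (map h rs)) \<in> borel_measurable \<nu>" if "h \<in> borel_measurable borel" for h :: "real \<Rightarrow> ennreal"
    using measurable_restrict_space1[OF sum_list_measurable_tuple_borel[OF that]]
    by (simp add: measurable_cong_sets[OF \<nu> HOL.refl])
  have sp: "space \<nu> \<subseteq> S" using sets_eq_imp_space_eq[OF \<nu>] by (simp add: space_restrict_space)
  have sp': "space (mark_intensity \<nu>) = {0..}"
    using sets_eq_imp_space_eq[OF sets_mark_intensity] by (simp add: space_restrict_space)
  show ?thesis
    using g
  proof (induction rule: borel_measurable_induct)
    case (cong f g)
    then have "f = g" by (simp add: fun_eq_iff)
    then show ?case using cong by simp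
  next
    case (set A)
    have A: "A \<inter> {0..} \<in> sets nonneg_borel" using set by (auto simp: sets_restrict_space)
    have "(\<integral>\<^sup>+ s. indicator A s \<partial>mark_intensity \<nu>) = emeasure (mark_intensity \<nu>) (A \<inter> {0..})"
      using A by (subst nn_integral_indicator') (simp_all add: sp')
    also have "\<dots> = (\<integral>\<^sup>+ rs. sum_list (map (indicator (A \<inter> {0..})) rs) \<partial>\<nu>)"
      by (rule emeasure_mark_intensity[OF \<nu> A])
    also have "\<dots> = (\<integral>\<^sup>+ rs. sum_list (map (indicator A) rs) \<partial>\<nu>)"
      using sp S by (intro nn_integral_cong arg_cong[of _ _ sum_list] map_cong) (auto simp: indicator_def)
    finally show ?case .
  next
    case (mult f c)
    then show ?case by (simp add: nn_integral_cmult I J sum_list_const_mult)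
  next
    case (add f g)
    then show ?case by (simp add: nn_integral_add I J sum_list_addf)
  next
    case (seq U)
    have pt: "sum_list (map (SUP i. U i) rs) = (SUP i. sum_list (map (U i) rs))" for rs
    proof (induction rs)
      case (Cons r rs)
      have "(SUP i. U i r + sum_list (map (U i) rs)) = (SUP i. U i r) + (SUP i. sum_list (map (U i) rs))"
        using seq(3) by (intro ennreal_SUP_add)
          (auto simp: incseq_def le_fun_def intro!: sum_list_mono)
      then show ?case using Cons by (simp add: image_comp)
    qed simp
    have "(\<integral>\<^sup>+ s. (SUP i. U i) s \<partial>mark_intensity \<nu>) = (SUP i. \<integral>\<^sup>+ s. U i s \<partial>mark_intensity \<nu>)"
      using seq by (simp add: image_comp nn_integral_monotone_convergence_SUP I)
    also have "\<dots> = (SUP i. \<integral>\<^sup>+ rs. sum_list (map (U i) rs) \<partial>\<nu>)" using seq by simp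
    also have "\<dots> = (\<integral>\<^sup>+ rs. (SUP i. sum_list (map (U i) rs)) \<partial>\<nu>)"
      using seq by (intro nn_integral_monotone_convergence_SUP[symmetric] J)
          (auto simp: incseq_def le_fun_def intro!: sum_list_mono)
    finally show ?case by (simp only: pt)
  qed
qed

lemma emeasure_le_sum_list_max_ball_mass:
  assumes T: "finite_tree T" and \<sigma>: "sets \<sigma> = sets (tree_borel T)" and rs: "rs \<in> covers T"
  shows "emeasure \<sigma> (points T) \<le> sum_list (map (max_ball_mass T \<sigma>) rs)"
proof -
  obtain vs where vs: "length vs = length rs" "set vs \<subseteq> points T"
      "points T \<subseteq> (\<Union>i<length rs. tball T (vs ! i) (rs ! i))"
    using rs by (auto simp: covers_def)
  have B: "(\<lambda>i. tball T (vs ! i) (rs ! i)) ` {..<length rs} \<subseteq> sets \<sigma>"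
    using tball_in_sets[OF T] \<sigma> by auto
  have "emeasure \<sigma> (points T) \<le> emeasure \<sigma> (\<Union>i<length rs. tball T (vs ! i) (rs ! i))"
    using vs(3) B by (intro emeasure_mono sets.finite_UN) auto
  also have "\<dots> \<le> (\<Sum>i<length rs. emeasure \<sigma> (tball T (vs ! i) (rs ! i)))"
    using B by (intro emeasure_subadditive_finite) auto
  also have "\<dots> \<le> (\<Sum>i<length rs. max_ball_mass T \<sigma> (rs ! i))"
    using vs(1,2) by (intro sum_mono emeasure_tball_le_max_ball_mass) auto
  also have "\<dots> = sum_list (map (max_ball_mass T \<sigma>) rs)"
    by (simp add: sum_list_sum_nth atLeast0LessThan)
  finally show ?thesis .
qed

text \<open>
  Average the bound \<open>emeasure_le_sum_list_max_ball_mass\<close> over the random cover: its left-hand side is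
  constant, and Campbell's formula evaluates the mean of its right-hand side.
\<close>

lemma cover_imp_ball_mass_condition:
  assumes T: "finite_tree T" and \<beta>: "sets \<beta> = sets (restrict_space borel {0..R})"
    and "cover_dominated T \<beta>"
  shows "ball_mass_condition T \<beta>"
  unfolding ball_mass_condition_def
proof (intro allI impI, elim conjE)
  fix \<sigma> assume \<sigma>: "sets \<sigma> = sets (tree_borel T)"
  obtain \<nu> where "prob_space \<nu>" and \<nu>: "sets \<nu> = sets (restrict_space tuple_borel (short_covers T))"
    and dom: "mark_intensity \<nu> \<le> extend_by_zero \<beta>"
    using assms(3) by (auto simp: cover_dominated_def)
  interpret prob_space \<nu> by fact
  note M = max_ball_mass_measurable[OF T \<sigma>]
  have sp: "space \<nu> \<subseteq> short_covers T"
    using sets_eq_imp_space_eq[OF \<nu>] by (simp add: space_restrict_space)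
  have "emeasure \<sigma> (points T) = (\<integral>\<^sup>+ rs. emeasure \<sigma> (points T) \<partial>\<nu>)"
    by (simp add: emeasure_space_1)
  also have "\<dots> \<le> (\<integral>\<^sup>+ rs. sum_list (map (max_ball_mass T \<sigma>) rs) \<partial>\<nu>)"
    using sp by (intro nn_integral_mono emeasure_le_sum_list_max_ball_mass[OF T \<sigma>])
      (auto simp: short_covers_def)
  also have "\<dots> = (\<integral>\<^sup>+ s. max_ball_mass T \<sigma> s \<partial>mark_intensity \<nu>)"
    by (rule nn_integral_mark_intensity[OF \<nu> _ M, symmetric])
      (auto simp: short_covers_def covers_def)
  also have "\<dots> \<le> (\<integral>\<^sup>+ s. max_ball_mass T \<sigma> s \<partial>extend_by_zero \<beta>)"
    using dom by (intro nn_integral_mono_measure) (simp_all add: extend_by_zero_def)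
  also have "\<dots> = (\<integral>\<^sup>+ s. max_ball_mass T \<sigma> s \<partial>\<beta>)"
    by (rule nn_integral_extend_by_zero[OF \<beta> M])
  finally show "emeasure \<sigma> (points T) \<le> (\<integral>\<^sup>+ s. max_ball_mass T \<sigma> s \<partial>\<beta>)" .
qed

section \<open>The length measure as a test measure\<close>

lemma sum_oriented_edges:
  fixes f :: "'v set \<Rightarrow> 'b::comm_semiring_1"
  assumes T: "finite_tree T"
  shows "(\<Sum>(u, v)\<in>{(u, v). {u, v} \<in> edges T}. f {u, v}) = 2 * (\<Sum>e\<in>edges T. f e)"
proof -
  let ?O = "{(u, v). {u, v} \<in> edges T}" and ?e = "\<lambda>(u, v). {u, v}"
  have "?e ` ?O = edges T"
  proof
    show "edges T \<subseteq> ?e ` ?O"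
    proof
      fix e assume "e \<in> edges T"
      moreover from this obtain u v where "e = {u, v}" using edge_cases[OF T] by metis
      ultimately show "e \<in> ?e ` ?O" by force
    qed
  qed auto
  moreover have "(\<Sum>p\<in>{p \<in> ?O. ?e p = e}. f (?e p)) = 2 * f e" if e: "e \<in> edges T" for e
  proof -
    obtain a b where ab: "e = {a, b}" "a \<noteq> b" using edge_cases[OF T e] by metis
    have "{p \<in> ?O. ?e p = e} = {(a, b), (b, a)}"
      using e ab by (auto simp: doubleton_eq_iff insert_commute)
    then show ?thesis using ab by (simp add: insert_commute mult_2)
  qed
  ultimately show ?thesis
    using sum.image_gen[OF finite_oriented_edges[OF T], of "\<lambda>p. f (?e p)" ?e]
    by (simp add: sum_distrib_left split_def)
qed

lemma sets_length_measure:
  assumes "finite_tree T" shows "sets (length_measure T) = sets (tree_borel T)"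
  unfolding length_measure_def
  using sets.sigma_sets_eq[of "tree_borel T"] sets.space_closed[of "tree_borel T"]
  by (simp add: space_tree_borel[OF assms] del: space_borel_of_topology)

text \<open>
  Up to the factor 1/2, the formula is a finite sum of the push-forwards \<open>N p\<close> of Lebesgue measure along
  the oriented edges. Each of them is a measure because the parametrization of an edge is continuous, and
  hence the sum is countably additive.
\<close>

lemma emeasure_length_measure:
  assumes T: "finite_tree T" and A: "A \<in> sets (tree_borel T)"
  shows "emeasure (length_measure T) A = (\<Sum>(u, v)\<in>{(u, v). {u, v} \<in> edges T}.
     emeasure lborel {t \<in> {0..elen T {u, v}}. edge_point T u v t \<in> A}) / 2"
proof -
  let ?O = "{(u, v). {u, v} \<in> edges T}"
  define N where "N p = distr (restrict_space lborel {0..elen T {fst p, snd p}}) (tree_borel T)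
    (edge_point T (fst p) (snd p))" for p
  have N: "emeasure (N p) B = emeasure lborel {t \<in> {0..elen T {fst p, snd p}}. edge_point T (fst p) (snd p) t \<in> B}"
    if "p \<in> ?O" "B \<in> sets (tree_borel T)" for p B
  proof -
    have "edge_point T (fst p) (snd p) \<in>
        measurable (restrict_space borel {0..elen T {fst p, snd p}}) (tree_borel T)"
      using that by (intro continuous_map_top_of_set_measurable continuous_map_edge_point[OF T]) auto
    then have "edge_point T (fst p) (snd p) \<in>
        measurable (restrict_space lborel {0..elen T {fst p, snd p}}) (tree_borel T)"
      by (simp cong: measurable_cong_sets sets_restrict_space_cong)
    then have "emeasure (N p) B = emeasure (restrict_space lborel {0..elen T {fst p, snd p}})
        {t \<in> {0..elen T {fst p, snd p}}. edge_point T (fst p) (snd p) t \<in> B}"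
      unfolding N_def using that
      by (subst emeasure_distr)
        (auto simp: space_restrict_space intro!: arg_cong2[of _ _ _ _ emeasure])
    also have "\<dots> = emeasure lborel {t \<in> {0..elen T {fst p, snd p}}. edge_point T (fst p) (snd p) t \<in> B}"
      by (rule emeasure_restrict_space) auto
    finally show ?thesis .
  qed
  have mu: "(\<Sum>(u, v)\<in>?O. emeasure lborel {t \<in> {0..elen T {u, v}}. edge_point T u v t \<in> B}) / 2
      = (\<Sum>p\<in>?O. emeasure (N p) B) / 2" if "B \<in> sets (tree_borel T)" for B
    using that by (auto simp: N split_def intro!: arg_cong2[of _ _ _ _ "(/)"] sum.cong)
  show ?thesis
  proof (rule emeasure_measure_of[OF length_measure_def])
    show "sets (tree_borel T) \<subseteq> Pow (points T)"
      using sets.space_closed[of "tree_borel T"] space_tree_borel[OF T] by simp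
    show "A \<in> sets (length_measure T)" using A by (simp add: sets_length_measure[OF T])
    show "positive (sets (length_measure T)) (\<lambda>A. (\<Sum>(u, v)\<in>?O.
        emeasure lborel {t \<in> {0..elen T {u, v}}. edge_point T u v t \<in> A}) / 2)"
      by (simp add: positive_def split_def)
    show "countably_additive (sets (length_measure T)) (\<lambda>A. (\<Sum>(u, v)\<in>?O.
        emeasure lborel {t \<in> {0..elen T {u, v}}. edge_point T u v t \<in> A}) / 2)"
    proof (rule countably_additiveI)
      fix B :: "nat \<Rightarrow> _"
      assume B: "range B \<subseteq> sets (length_measure T)" "disjoint_family B"
        "(\<Union>i. B i) \<in> sets (length_measure T)"
      have "(\<Sum>i. (\<Sum>p\<in>?O. emeasure (N p) (B i)) / 2) = (\<Sum>p\<in>?O. emeasure (N p) (\<Union>i. B i)) / 2"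
      proof -
        have "(\<Sum>i. emeasure (N p) (B i)) = emeasure (N p) (\<Union>i. B i)" for p
          using B sets_length_measure[OF T] by (intro suminf_emeasure) (auto simp: N_def)
        then show ?thesis
          by (simp add: divide_ennreal_def suminf_sum summableI)
      qed
      then show "(\<Sum>i. (\<Sum>(u, v)\<in>?O. emeasure lborel {t \<in> {0..elen T {u, v}}. edge_point T u v t \<in> B i}) / 2)
        = (\<Sum>(u, v)\<in>?O. emeasure lborel {t \<in> {0..elen T {u, v}}. edge_point T u v t \<in> (\<Union>i. B i)}) / 2"
        using B sets_length_measure[OF T] by (subst (1 2) mu) auto
    qed
  qed
qed

lemma length_measure_total:
  assumes T: "finite_tree T"
  shows "emeasure (length_measure T) (points T) = ennreal (total_length T)"
proof -
  let ?O = "{(u, v). {u, v} \<in> edges T}"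
  have pos: "0 < elen T e" if "e \<in> edges T" for e using T that by (auto simp: finite_tree_def)
  have "(\<Sum>(u, v)\<in>?O. emeasure lborel {t \<in> {0..elen T {u, v}}. edge_point T u v t \<in> points T})
      = (\<Sum>(u, v)\<in>?O. ennreal (elen T {u, v}))"
  proof (intro sum.cong HOL.refl, clarify)
    fix u v assume e: "{u, v} \<in> edges T"
    have "{t \<in> {0..elen T {u, v}}. edge_point T u v t \<in> points T} = {0..elen T {u, v}}"
      using edge_point_in_cell[OF edge_endpoints(1,4)[OF T e]] cell_subset_points[OF e] by auto
    then show "emeasure lborel {t \<in> {0..elen T {u, v}}. edge_point T u v t \<in> points T}
        = ennreal (elen T {u, v})"
      using pos[OF e] by simp
  qed
  also have "\<dots> = 2 * ennreal (total_length T)"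
    using pos by (simp add: sum_oriented_edges[OF T, of "\<lambda>e. ennreal (elen T e)"]
      total_length_def sum_ennreal less_imp_le)
  finally show ?thesis
    using emeasure_length_measure[OF T sets.top[of "tree_borel T"]]
    by (simp add: space_tree_borel[OF T] ennreal_mult_divide_eq mult.commute[of 2]
        del: space_borel_of_topology)
qed

lemma ball_mass_condition_imp_profile:
  assumes T: "finite_tree T" and c: "ball_mass_condition T \<beta>"
  shows "ennreal (total_length T) \<le> (\<integral>\<^sup>+ s. ball_volume_profile T s \<partial>\<beta>)"
proof -
  have "space (length_measure T) = points T"
    using sets_eq_imp_space_eq[OF sets_length_measure[OF T]] space_tree_borel[OF T] by simp
  then have "finite_measure (length_measure T)"
    by (intro finite_measureI) (simp add: length_measure_total[OF T])
  then show ?thesis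
    using c sets_length_measure[OF T] length_measure_total[OF T]
    unfolding ball_mass_condition_def ball_volume_profile_def by metis
qed

section \<open>Counting measures as test measures\<close>

text \<open>
  Two points of \<open>P\<close> in a common ball of radius \<open>s\<close> are at distance at most \<open>2 s\<close>, so for \<open>s < \<delta> / 2\<close> a ball
  contains at most one of them.
\<close>

lemma ball_mass_condition_imp_packing:
  assumes T: "finite_tree T" and \<beta>: "sets \<beta> = sets (restrict_space borel {0..R})"
    and c: "ball_mass_condition T \<beta>"
    and P: "P \<subseteq> points T" "finite P"
    and sep: "\<And>x y. x \<in> P \<Longrightarrow> y \<in> P \<Longrightarrow> x \<noteq> y \<Longrightarrow> \<delta> \<le> path_dist T x y"
  shows "of_nat (card P) \<le> emeasure \<beta> ({0..R} \<inter> {0..<\<delta> / 2})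
    + of_nat (card P) * emeasure \<beta> ({0..R} \<inter> {\<delta> / 2..})"
proof -
  interpret Metric_space "points T" "path_dist T" by (rule Metric_space_tree[OF T])
  define \<sigma> where "\<sigma> = distr (count_space P) (tree_borel T) (\<lambda>x. x)"
  have \<sigma>: "sets \<sigma> = sets (tree_borel T)" by (simp add: \<sigma>_def)
  have em: "emeasure \<sigma> A = of_nat (card (A \<inter> P))" if "A \<in> sets (tree_borel T)" for A
    unfolding \<sigma>_def using that P
    by (subst emeasure_distr) (auto simp: emeasure_count_space)
  have pts: "points T \<in> sets (tree_borel T)"
    using sets.top[of "tree_borel T"] space_tree_borel[OF T] by simp
  have tot: "emeasure \<sigma> (points T) = of_nat (card P)"
    using em[OF pts] P by (simp add: Int_absorb1)
  have "finite_measure \<sigma>"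
    using tot by (intro finite_measureI) (simp add: \<sigma>_def)
  with c \<sigma> have "of_nat (card P) \<le> (\<integral>\<^sup>+ s. max_ball_mass T \<sigma> s \<partial>\<beta>)"
    unfolding ball_mass_condition_def tot[symmetric] by blast
  also have "\<dots> \<le> (\<integral>\<^sup>+ s. indicator ({0..R} \<inter> {0..<\<delta> / 2}) s
      + of_nat (card P) * indicator ({0..R} \<inter> {\<delta> / 2..}) s \<partial>\<beta>)"
  proof (rule nn_integral_mono)
    fix s assume "s \<in> space \<beta>"
    then have s: "s \<in> {0..R}"
      using sets_eq_imp_space_eq[OF \<beta>] by (simp add: space_restrict_space)
    have "emeasure \<sigma> (tball T v s) \<le> indicator ({0..R} \<inter> {0..<\<delta> / 2}) s
      + of_nat (card P) * indicator ({0..R} \<inter> {\<delta> / 2..}) s" if v: "v \<in> points T" for v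
    proof (cases "s < \<delta> / 2")
      case True
      have "x = y" if "x \<in> tball T v s \<inter> P" "y \<in> tball T v s \<inter> P" for x y
      proof (rule ccontr)
        assume "x \<noteq> y"
        then have "\<delta> \<le> path_dist T x y" using sep that by auto
        also have "\<dots> \<le> path_dist T x v + path_dist T v y"
          using that v by (intro triangle) auto
        also have "\<dots> \<le> s + s" using that by (auto simp: commute[of x v])
        finally show False using True by simp
      qed
      then have "card (tball T v s \<inter> P) \<le> 1"
        using P by (auto simp: card_le_Suc0_iff_eq)
      then have "(of_nat (card (tball T v s \<inter> P)) :: ennreal) \<le> 1"
        using of_nat_mono by fastforce
      then show ?thesis using True s by (simp add: em[OF tball_in_sets[OF T]])
    next
      case False
      have "card (tball T v s \<inter> P) \<le> card P" using P by (intro card_mono) auto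
      then show ?thesis using False s by (simp add: em[OF tball_in_sets[OF T]] of_nat_mono)
    qed
    then show "max_ball_mass T \<sigma> s \<le> indicator ({0..R} \<inter> {0..<\<delta> / 2}) s
      + of_nat (card P) * indicator ({0..R} \<inter> {\<delta> / 2..}) s"
      unfolding max_ball_mass_def by (rule SUP_least)
  qed
  also have "\<dots> = emeasure \<beta> ({0..R} \<inter> {0..<\<delta> / 2})
    + of_nat (card P) * emeasure \<beta> ({0..R} \<inter> {\<delta> / 2..})"
  proof -
    have "{0..R} \<inter> {0..<\<delta> / 2} \<in> sets \<beta>" "{0..R} \<inter> {\<delta> / 2..} \<in> sets \<beta>"
      unfolding \<beta> by (auto simp: sets_restrict_space)
    then show ?thesis
      by (subst nn_integral_add) (auto simp: nn_integral_cmult)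
  qed
  finally show ?thesis .
qed

section \<open>Consequences of domination by a measure on radii\<close>

theorem corollary5p1:
  fixes T :: "'v weighted_graph" and R :: real and \<beta> :: "real measure"
  assumes "finite_tree T" and "nontrivial T"
    and "0 < R" and "R \<le> total_length T"
    and "finite_measure \<beta>" and "sets \<beta> = sets (restrict_space borel {0..R})"
    and "cover_dominated T \<beta> \<or> fractionally_dominated T R \<beta> \<or> ball_mass_condition T \<beta>"
  shows "ennreal (total_length T) \<le> (\<integral>\<^sup>+ s. ball_volume_profile T s \<partial>\<beta>) \<and>
         (\<forall>P (m::nat) (\<delta>::real).
           P \<subseteq> points T \<and> finite P \<and> card P = m \<and> 2 \<le> m \<and> 0 < \<delta> \<and>
           (\<forall>x\<in>P. \<forall>y\<in>P. x \<noteq> y \<longrightarrow> \<delta> \<le> path_dist T x y) \<longrightarrow>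
           of_nat m \<le> emeasure \<beta> ({0..R} \<inter> {0..<\<delta> / 2})
                    + of_nat m * emeasure \<beta> ({0..R} \<inter> {\<delta> / 2..}))"
proof -
  have c: "ball_mass_condition T \<beta>"
    using assms(7) cover_imp_ball_mass_condition[OF assms(1,6)]
      fractional_imp_ball_mass_condition[OF assms(1,6)] by blast
  show ?thesis
    using ball_mass_condition_imp_profile[OF assms(1) c]
      ball_mass_condition_imp_packing[OF assms(1,6) c] by blast
qed

end
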